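(* Let $B,\Phi\in\mathcal{C}(I,\mathrm{K}_c(\mathbb{R}))$ with $B(t_1)-\Phi(t_1)=B(t_\infty)-\Phi(t_\infty)$, and let $\{I\times\mathrm{K}_c(\mathbb{R});\,G_i:i\in\mathbb{N}\}$ be the countable iterated function system of the maps $G_i:I\times\mathrm{K}_c(\mathbb{R})\to I\times\mathrm{K}_c(\mathbb{R})$, $$G_i(t,S)=\big(\zeta_i(t),\ \alpha S+\Phi(\zeta_i(t))-\alpha B(t)\big),$$ where $\max\{|\alpha|,a_i\}<1$ for each $i\in\mathbb{N}$. Suppose that $$b_i\,d_{\mathcal{G}}((t,S_1),(w,S_2))\le d_{\mathcal{G}}(G_i(t,S_1),G_i(w,S_2))\le c_i\,d_{\mathcal{G}}((t,S_1),(w,S_2))$$ for every $(t,S_1),(w,S_2)\in I\times\mathrm{K}_c(\mathbb{R})$, where $0<b_i\le c_i<1$ for all $i\in\mathbb{N}$. Then $$s_*\le\dim_H(\mathcal{G}(\Phi^{\alpha}))\le\dim_B(\mathcal{G}(\Phi^{\alpha}))\le s^*,$$ where $s_*=\sup_{k\ge2}s_k$, each $s_k$ being uniquely defined by $\sum_{i=1}^{k}b_i^{s_k}=1$, and $$s^*=\max\Big\{\inf\Big\{s:\sum_{i\in\mathbb{N}}c_i^{s}\le1\Big\},\,1\Big\}.$$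
   Context: $\mathrm{K}(\mathbb{R})$ is the set of all non-empty compact subsets of $\mathbb{R}$ with the Hausdorff metric $H_d$; $\mathrm{K}_c(\mathbb{R})$ is the subset of non-empty compact convex subsets. $\mathcal{C}(I,\mathrm{K}(\mathbb{R}))$ and $\mathcal{C}(I,\mathrm{K}_c(\mathbb{R}))$ are the sets of continuous maps from $I$. Set operations are Minkowski operations: $C\pm D=\{c\pm d:c\in C,d\in D\}$ and $\alpha C=\{\alpha c:c\in C\}$. Setting: $t_1<t_2<\cdots$ is a strictly increasing real sequence with finite limit $t_\infty$, $I=[t_1,t_\infty]$, $\vartheta=(t_1,t_2,\ldots,t_\infty)$, $I_n=[t_n,t_{n+1}]$ for $n\in J=\mathbb{N}=\{1,2,3,\ldots\}$, and for each $n$, $\zeta_n:I\to I_n$ is a contraction homeomorphism, with contraction coefficient $a_n$ (i.e. $|\zeta_n(t)-\zeta_n(w)|\le a_n|t-w|$), such that either $\zeta_n(t_1)=t_n,\ \zeta_n(t_\infty)=t_{n+1}$ or $\zeta_n(t_1)=t_{n+1},\ \zeta_n(t_\infty)=t_n$. For $\alpha\in\mathbb{R}$ with $|\alpha|<1$, $\Phi^\alpha=\Phi^{\alpha}_{\vartheta,B}$ denotes the continuous function (which the paper asserts to exist and be unique, and in this setting to take values in $\mathrm{K}_c(\mathbb{R})$) satisfying $\Phi^{\alpha}(t)=\Phi(t)+\alpha[\Phi^{\alpha}(\zeta_n^{-1}(t))-B(\zeta_n^{-1}(t))]$ for all $t\in I_n$, $n\in J$, and $\Phi^{\alpha}(t_\infty)=\lim_{n\to\infty}\big(\Phi(t_n)+\alpha[\Phi^{\alpha}(\zeta_n^{-1}(t_n))-B(\zeta_n^{-1}(t_n))]\big)$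 (limit in $H_d$). The graph of $\Phi^\alpha$ is $\mathcal{G}(\Phi^{\alpha})=\{(t,\Phi^{\alpha}(t)):t\in I\}\subset I\times\mathrm{K}_c(\mathbb{R})$. The metric $d_{\mathcal{G}}$ is $d_{\mathcal{G}}((t,S_1),(w,S_2))=|t-w|+H_d(S_1,S_2)$. $\dim_H$ and $\dim_B$ are the Hausdorff and box-counting dimensions with respect to $d_{\mathcal{G}}$, where $\dim_B(E)=\lim_{\delta\to0}\frac{\log N_\delta(E)}{-\log\delta}$ with $N_\delta(E)$ the least number of sets of diameter at most $\delta$ covering $E$. *)

theory Defs
  imports "HOL-Analysis.Analysis"
begin

section \<open>Compact subsets of the real line\<close>

definition KR :: "real set set" where
  "KR = {C. compact C \<and> C \<noteq> {}}"

definition KcR :: "real set set" where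
  "KcR = {C. compact C \<and> C \<noteq> {} \<and> convex C}"

text \<open>
  The value \<open>0\<close> outside \<open>KR\<close> is arbitrary; it is there because the locale
  \<^locale>\<open>Metric_space\<close> wants a distance that is nonnegative on the whole type.
\<close>

definition hausdorff_dist :: "real set \<Rightarrow> real set \<Rightarrow> real" where
  "hausdorff_dist C D =
     (if C \<in> KR \<and> D \<in> KR
      then max (SUP c\<in>C. infdist c D) (SUP d\<in>D. infdist d C) else 0)"

text \<open>
  Minkowski sums and scalar multiples are \<open>C + D\<close> and \<open>\<alpha> *o C\<close> of
  \<^theory>\<open>HOL-Library.Set_Algebras\<close>.  The Minkowski difference needs its own name,
  since \<open>C - D\<close> on sets is the set-theoretic difference.
\<close>

definition mink_diff :: "real set \<Rightarrow> real set \<Rightarrow> real set"  (infixl "\<ominus>\<^sub>M" 65) where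
  "C \<ominus>\<^sub>M D = {c - d | c d. c \<in> C \<and> d \<in> D}"

lemma hausdorff_dist_commute: "hausdorff_dist C D = hausdorff_dist D C"
  by (simp add: hausdorff_dist_def max.commute conj_commute)

lemma infdist_le_hausdorff_dist:
  assumes "C \<in> KR" "D \<in> KR" "c \<in> C" shows "infdist c D \<le> hausdorff_dist C D"
proof -
  have "compact ((\<lambda>c. infdist c D) ` C)"
    using assms by (intro compact_continuous_image continuous_intros) (auto simp: KR_def)
  then have "bdd_above ((\<lambda>c. infdist c D) ` C)"
    by (intro bounded_imp_bdd_above compact_imp_bounded)
  from cSUP_upper[OF assms(3) this] assms(1,2) show ?thesis
    by (simp add: hausdorff_dist_def)
qed

lemma hausdorff_dist_leI:
  assumes "C \<in> KR" "D \<in> KR" "\<And>c. c \<in> C \<Longrightarrow> infdist c D \<le> r" "\<And>d. d \<in> D \<Longrightarrow> infdist d C \<le> r"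
  shows "hausdorff_dist C D \<le> r"
proof -
  have "C \<noteq> {}" "D \<noteq> {}"
    using assms(1,2) by (auto simp: KR_def)
  then show ?thesis
    using assms by (auto simp: hausdorff_dist_def intro!: cSUP_least)
qed

lemma hausdorff_dist_nonneg: "0 \<le> hausdorff_dist C D"
proof (cases "C \<in> KR \<and> D \<in> KR")
  case True
  then obtain c where "c \<in> C" by (auto simp: KR_def)
  with infdist_le_hausdorff_dist[of C D c] infdist_nonneg[of c D] True show ?thesis
    by linarith
qed (auto simp: hausdorff_dist_def)

lemma hausdorff_dist_subset:
  assumes "C \<in> KR" "D \<in> KR" "hausdorff_dist C D = 0" shows "C \<subseteq> D"
proof
  fix c assume "c \<in> C"
  then have "infdist c D = 0"
    using infdist_le_hausdorff_dist[of C D c] infdist_nonneg[of c D] assms by linarith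
  then show "c \<in> D"
    using assms(2) in_closed_iff_infdist_zero[of D c] by (auto simp: KR_def compact_imp_closed)
qed

lemma infdist_triangle_hausdorff:
  assumes "D \<in> KR" "E \<in> KR"
  shows "infdist c E \<le> infdist c D + hausdorff_dist D E"
proof -
  obtain d where d: "d \<in> D" "infdist c D = dist c d"
    using infdist_attains_inf[of D c] assms(1) by (auto simp: KR_def compact_imp_closed)
  have "infdist c E \<le> infdist d E + dist c d"
    by (rule infdist_triangle)
  with d infdist_le_hausdorff_dist[OF assms d(1)] show ?thesis by linarith
qed

lemma hausdorff_dist_triangle:
  assumes "C \<in> KR" "D \<in> KR" "E \<in> KR"
  shows "hausdorff_dist C E \<le> hausdorff_dist C D + hausdorff_dist D E"
proof (rule hausdorff_dist_leI)
  fix c assume "c \<in> C"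
  then show "infdist c E \<le> hausdorff_dist C D + hausdorff_dist D E"
    using infdist_triangle_hausdorff[of D E c] infdist_le_hausdorff_dist[of C D c] assms
    by linarith
next
  fix e assume "e \<in> E"
  then show "infdist e C \<le> hausdorff_dist C D + hausdorff_dist D E"
    using infdist_triangle_hausdorff[of D C e] infdist_le_hausdorff_dist[of E D e] assms
      hausdorff_dist_commute[of C D] hausdorff_dist_commute[of D E]
    by linarith
qed (use assms in auto)

lemma Metric_space_hausdorff_dist: "Metric_space KR hausdorff_dist"
proof
  fix C D :: "real set" assume KR: "C \<in> KR" "D \<in> KR"
  show "hausdorff_dist C D = 0 \<longleftrightarrow> C = D"
  proof
    assume "hausdorff_dist C D = 0"
    then show "C = D"
      using KR hausdorff_dist_subset[of C D] hausdorff_dist_subset[of D C]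
        hausdorff_dist_commute[of C D] by auto
  next
    assume "C = D"
    then have "hausdorff_dist C D \<le> 0"
      using KR by (intro hausdorff_dist_leI) auto
    then show "hausdorff_dist C D = 0"
      using hausdorff_dist_nonneg[of C D] by linarith
  qed
qed (auto simp: hausdorff_dist_nonneg hausdorff_dist_commute hausdorff_dist_triangle)


section \<open>Dimensions of a set with respect to a metric\<close>

text \<open>
  All covering sets below are taken to be subsets of \<open>E\<close>.  This loses nothing, as a
  covering set \<open>U\<close> may be replaced by \<open>U \<inter> E\<close>, whose diameter is not larger; so the
  metric \<open>d\<close> only matters on \<open>E\<close>.
\<close>

definition diam :: "('a \<Rightarrow> 'a \<Rightarrow> real) \<Rightarrow> 'a set \<Rightarrow> ennreal" where
  "diam d U = (SUP x\<in>U. SUP y\<in>U. ennreal (d x y))"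

definition hausdorff_premeasure ::
    "('a \<Rightarrow> 'a \<Rightarrow> real) \<Rightarrow> real \<Rightarrow> real \<Rightarrow> 'a set \<Rightarrow> ennreal" where
  "hausdorff_premeasure d s \<delta> E =
     (INF U\<in>{U :: nat \<Rightarrow> 'a set. E = (\<Union>n. U n) \<and> (\<forall>n. diam d (U n) \<le> ennreal \<delta>)}.
        \<Sum>n. ennreal (enn2real (diam d (U n)) powr s))"

definition hausdorff_measure ::
    "('a \<Rightarrow> 'a \<Rightarrow> real) \<Rightarrow> real \<Rightarrow> 'a set \<Rightarrow> ennreal" where
  "hausdorff_measure d s E = (SUP \<delta>\<in>{0<..}. hausdorff_premeasure d s \<delta> E)"

text \<open>
  Only exponents \<open>s > 0\<close> are used, so that the convention for \<open>0\<close> to the power \<open>0\<close>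
  plays no role; the infimum is the same as over \<open>s \<ge> 0\<close>.
\<close>

definition hausdorff_dim :: "('a \<Rightarrow> 'a \<Rightarrow> real) \<Rightarrow> 'a set \<Rightarrow> ereal" where
  "hausdorff_dim d E = Inf {ereal s | s. 0 < s \<and> hausdorff_measure d s E = 0}"

definition finite_cover ::
    "('a \<Rightarrow> 'a \<Rightarrow> real) \<Rightarrow> real \<Rightarrow> 'a set \<Rightarrow> 'a set set \<Rightarrow> bool" where
  "finite_cover d \<delta> E \<U> \<longleftrightarrow> finite \<U> \<and> E = \<Union>\<U> \<and> (\<forall>U\<in>\<U>. diam d U \<le> ennreal \<delta>)"

definition covering_number :: "('a \<Rightarrow> 'a \<Rightarrow> real) \<Rightarrow> real \<Rightarrow> 'a set \<Rightarrow> nat" where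
  "covering_number d \<delta> E = (LEAST n. \<exists>\<U>. finite_cover d \<delta> E \<U> \<and> card \<U> = n)"

text \<open>
  \<open>has_box_dim d E D\<close>: the limit defining the box-counting dimension exists and equals \<open>D\<close>.
  The first conjunct makes every covering number a genuine minimum.
\<close>

definition has_box_dim :: "('a \<Rightarrow> 'a \<Rightarrow> real) \<Rightarrow> 'a set \<Rightarrow> ereal \<Rightarrow> bool" where
  "has_box_dim d E D \<longleftrightarrow>
     (\<forall>\<delta>>0. \<exists>\<U>. finite_cover d \<delta> E \<U>) \<and>
     ((\<lambda>\<delta>. ereal (ln (real (covering_number d \<delta> E)) / - ln \<delta>)) \<longlongrightarrow> D) (at_right 0)"


section \<open>Set-valued fractal functions\<close>

definition continuous_into :: "real set \<Rightarrow> real set set \<Rightarrow> (real \<Rightarrow> real set) \<Rightarrow> bool" where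
  "continuous_into I M \<Phi> \<longleftrightarrow>
     continuous_map (top_of_set I) (Metric_space.mtopology M hausdorff_dist) \<Phi>"

text \<open>
  \<open>is_fractal_function t tinf \<zeta> \<alpha> \<Phi> B F\<close>: the function \<open>F\<close> is the \<open>\<alpha>\<close>-fractal function of \<open>\<Phi>\<close>
  with base function \<open>B\<close>.  Sequences are indexed by \<open>1, 2, 3, \<dots>\<close>; the value at
  index \<open>0\<close> is irrelevant.
\<close>

definition is_fractal_function ::
    "(nat \<Rightarrow> real) \<Rightarrow> real \<Rightarrow> (nat \<Rightarrow> real \<Rightarrow> real) \<Rightarrow> real \<Rightarrow>
     (real \<Rightarrow> real set) \<Rightarrow> (real \<Rightarrow> real set) \<Rightarrow> (real \<Rightarrow> real set) \<Rightarrow> bool" where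
  "is_fractal_function t tinf \<zeta> \<alpha> \<Phi> B F \<longleftrightarrow>
     (let I = {t 1..tinf}; \<zeta>' = (\<lambda>n. inv_into I (\<zeta> n)) in
        continuous_into I KR F \<and>
        (\<forall>n\<ge>1. \<forall>x\<in>{t n..t (Suc n)}. F x = \<Phi> x + \<alpha> *o (F (\<zeta>' n x) \<ominus>\<^sub>M B (\<zeta>' n x))) \<and>
        limitin (Metric_space.mtopology KR hausdorff_dist)
          (\<lambda>n. \<Phi> (t n) + \<alpha> *o (F (\<zeta>' n (t n)) \<ominus>\<^sub>M B (\<zeta>' n (t n)))) (F tinf) sequentially)"

definition graph_metric :: "real \<times> real set \<Rightarrow> real \<times> real set \<Rightarrow> real" where
  "graph_metric = (\<lambda>(t, S\<^sub>1) (w, S\<^sub>2). \<bar>t - w\<bar> + hausdorff_dist S\<^sub>1 S\<^sub>2)"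

definition graph_on :: "real set \<Rightarrow> (real \<Rightarrow> real set) \<Rightarrow> (real \<times> real set) set" where
  "graph_on I F = {(t, F t) | t. t \<in> I}"

definition ifs_map ::
    "(nat \<Rightarrow> real \<Rightarrow> real) \<Rightarrow> real \<Rightarrow> (real \<Rightarrow> real set) \<Rightarrow> (real \<Rightarrow> real set) \<Rightarrow>
     nat \<Rightarrow> real \<times> real set \<Rightarrow> real \<times> real set" where
  "ifs_map \<zeta> \<alpha> \<Phi> B i = (\<lambda>(t, S). (\<zeta> i t, (\<alpha> *o S + \<Phi> (\<zeta> i t)) \<ominus>\<^sub>M (\<alpha> *o B t)))"

text \<open>
  For \<open>k \<ge> 2\<close> and \<open>b i\<close> in \<open>{0<..<1}\<close> the equation has exactly one real solution.
\<close>

definition s_fin :: "(nat \<Rightarrow> real) \<Rightarrow> nat \<Rightarrow> real" where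
  "s_fin b k = (THE s. (\<Sum>i=1..k. b i powr s) = 1)"

definition s_lower :: "(nat \<Rightarrow> real) \<Rightarrow> ereal" where
  "s_lower b = (SUP k\<in>{2..}. ereal (s_fin b k))"

text \<open>The infimum is taken in \<^typ>\<open>ereal\<close>, hence it is \<open>\<infinity>\<close> if no \<open>s\<close> qualifies.\<close>

definition s_upper :: "(nat \<Rightarrow> real) \<Rightarrow> ereal" where
  "s_upper c =
     max (Inf {ereal s | s. (\<lambda>i. c i powr s) summable_on {1..} \<and> (\<Sum>\<^sub>\<infinity>i\<in>{1..}. c i powr s) \<le> 1}) 1"

end

theory Submission
  imports Defs
begin

text \<open>
  Continuity forces \<open>F\<close> to be a translate of \<open>B\<close>: the intervals \<open>\<zeta>\<^sub>n(I)\<close> shrink to \<open>t\<^sub>\<infinity>\<close>, so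
  the limit of \<open>F(\<zeta>\<^sub>n(x)) = \<Phi>(\<zeta>\<^sub>n(x)) + \<alpha>(F(x) - B(x))\<close> is
  \<open>F(t\<^sub>\<infinity>) = \<Phi>(t\<^sub>\<infinity>) + \<alpha>(F(x) - B(x))\<close> for every \<open>x\<close>.  Likewise, the upper bounds on the maps
  \<open>G\<^sub>n\<close> at equal second arguments pass to the limit and make \<open>\<alpha>B\<close> Lipschitz.  Each value of \<open>F\<close> is
  a convex set plus \<open>\<alpha>\<close> times another value of \<open>F\<close>, hence is convex, since \<open>\<bar>\<alpha>\<bar> < 1\<close>; so Minkowski
  summands can be cancelled and \<open>F\<close> is Lipschitz.  The graph is then a bi-Lipschitz image of \<open>I\<close>,
  both dimensions equal 1, and \<open>s\<^sub>* \<le> 1\<close> because the lower bounds on \<open>G\<^sub>i\<close> give \<open>b\<^sub>i \<bar>I\<bar> \<le> \<bar>I\<^sub>i\<bar>\<close>.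
\<close>

section \<open>Minkowski operations and the Hausdorff distance\<close>

text \<open>Differences are turned into sums so that the commutative monoid laws for sets apply.
  Scaled copies do not cancel: \<open>C + (-1) *o C\<close> is in general larger than the zero
  set.\<close>

lemma mink_diff_eq: "C \<ominus>\<^sub>M D = C + (-1) *o D"
  by (force simp: mink_diff_def set_plus_def elt_set_times_def)

lemma scale_mink_diff: "r *o (C \<ominus>\<^sub>M D) = r *o C + (- r) *o D"
  by (simp add: mink_diff_eq set_times_plus_distrib2 set_times_rearrange2)

lemma mink_diff_scale: "C \<ominus>\<^sub>M (r *o D) = C + (- r) *o D"
  by (simp add: mink_diff_eq set_times_rearrange2)

lemma elt_set_times_eq_image: "r *o C = (\<lambda>x. r *\<^sub>R x) ` C" for r :: real
  by (auto simp: elt_set_times_def)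

lemma KcR_subset_KR: "KcR \<subseteq> KR"
  by (auto simp: KcR_def KR_def)

lemma KcR_iff: "C \<in> KcR \<longleftrightarrow> C \<in> KR \<and> convex C"
  by (auto simp: KcR_def KR_def)

lemma KR_plus: "C \<in> KR \<Longrightarrow> D \<in> KR \<Longrightarrow> C + D \<in> KR"
proof -
  assume "C \<in> KR" "D \<in> KR"
  moreover have "C + D = {x + y | x y. x \<in> C \<and> y \<in> D}"
    by (auto simp: set_plus_def)
  ultimately show ?thesis
    using compact_sums[of C D] by (auto simp: KR_def)
qed

lemma KR_scale: "C \<in> KR \<Longrightarrow> r *o C \<in> KR"
  using compact_scaling[of C r] by (simp add: KR_def elt_set_times_eq_image)

lemma KcR_plus: "C \<in> KcR \<Longrightarrow> D \<in> KcR \<Longrightarrow> C + D \<in> KcR"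
  by (simp add: KcR_iff KR_plus convex_set_plus)

lemma KcR_scale: "C \<in> KcR \<Longrightarrow> r *o C \<in> KcR"
  using convex_scaling[of C r] KR_scale[of C r] by (simp add: KcR_iff elt_set_times_eq_image)

lemma singleton_KcR: "{x} \<in> KcR"
  by (simp add: KcR_def)

lemma hausdorff_dist_eq_0: "C \<in> KR \<Longrightarrow> D \<in> KR \<Longrightarrow> hausdorff_dist C D = 0 \<longleftrightarrow> C = D"
  using Metric_space.zero[OF Metric_space_hausdorff_dist] by blast

lemma hausdorff_dist_singleton: "hausdorff_dist {x} {y} = \<bar>x - y\<bar>"
  by (simp add: hausdorff_dist_def KR_def infdist_def dist_real_def abs_minus_commute)

lemma hausdorff_dist_attained:
  assumes "C \<in> KR" "D \<in> KR" "x \<in> C"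
  obtains y where "y \<in> D" "dist x y \<le> hausdorff_dist C D"
proof -
  obtain y where "y \<in> D" "infdist x D = dist x y"
    using infdist_attains_inf[of D x] assms(2) by (auto simp: KR_def compact_imp_closed)
  with infdist_le_hausdorff_dist[OF assms] that show thesis
    by metis
qed

lemma hausdorff_dist_scale_le:
  assumes "C \<in> KR" "D \<in> KR"
  shows "hausdorff_dist (r *o C) (r *o D) \<le> \<bar>r\<bar> * hausdorff_dist C D"
proof -
  have *: "infdist x (r *o D) \<le> \<bar>r\<bar> * hausdorff_dist C D"
    if CD: "C \<in> KR" "D \<in> KR" and x: "x \<in> r *o C" for x C D
  proof -
    obtain y where y: "y \<in> C" "x = r * y"
      using x by (auto simp: elt_set_times_def)
    obtain z where z: "z \<in> D" "dist y z \<le> hausdorff_dist C D"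
      using hausdorff_dist_attained[OF CD y(1)] .
    have "infdist x (r *o D) \<le> dist x (r * z)"
      by (rule infdist_le) (use z in auto)
    also have "\<dots> = \<bar>r\<bar> * dist y z"
      unfolding y(2) dist_real_def abs_mult[symmetric] by (simp add: right_diff_distrib)
    finally show ?thesis
      using mult_left_mono[OF z(2), of "\<bar>r\<bar>"] by simp
  qed
  show ?thesis
    using *[OF assms] *[OF assms(2,1)] assms
    by (intro hausdorff_dist_leI KR_scale) (auto simp: hausdorff_dist_commute[of D C])
qed

lemma hausdorff_dist_plus_le:
  assumes "C \<in> KR" "D \<in> KR" "E \<in> KR"
  shows "hausdorff_dist (C + E) (D + E) \<le> hausdorff_dist C D"
proof -
  have *: "infdist x (D + E) \<le> hausdorff_dist C D"
    if CD: "C \<in> KR" "D \<in> KR" and x: "x \<in> C + E" for x C D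
  proof -
    obtain y e where y: "y \<in> C" "e \<in> E" "x = y + e"
      using x by (auto simp: set_plus_def)
    obtain z where z: "z \<in> D" "dist y z \<le> hausdorff_dist C D"
      using hausdorff_dist_attained[OF CD y(1)] .
    have "infdist x (D + E) \<le> dist x (z + e)"
      by (rule infdist_le) (use z y in auto)
    with z(2) y(3) show ?thesis by simp
  qed
  show ?thesis
    using *[OF assms(1,2)] *[OF assms(2,1)] assms
    by (intro hausdorff_dist_leI KR_plus) (auto simp: hausdorff_dist_commute[of D C])
qed

text \<open>For convex sets the distance is determined by the end points, and those are additive.\<close>

lemma hausdorff_dist_plus_cancel:
  assumes "C \<in> KcR" "D \<in> KcR" "E \<in> KR"
  shows "hausdorff_dist C D \<le> hausdorff_dist (C + E) (D + E)"
proof -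
  have *: "infdist x D \<le> hausdorff_dist (C + E) (D + E)"
    if C: "C \<in> KcR" and D: "D \<in> KcR" and x: "x \<in> C" for x C D
  proof -
    define r where "r = hausdorff_dist (C + E) (D + E)"
    have K: "C \<in> KR" "D \<in> KR" "C + E \<in> KR" "D + E \<in> KR"
      using C D assms(3) by (auto simp: KcR_iff KR_plus)
    obtain p q where pq: "D = {p..q}" "p \<le> q"
      using connected_compact_interval_1[of D] D
      by (auto simp: KcR_def convex_connected)
    \<comment> \<open>The extreme points of \<open>E\<close> turn sums into one-sided bounds: the
      partner of \<open>x + e\<close> in \<open>D + E\<close> is at most \<open>q + e\<close>, which
      bounds \<open>x\<close> from above; the partner of \<open>x + f\<close> is at least
      \<open>p + f\<close>, which bounds \<open>x\<close> from below.\<close>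
    obtain e where e: "e \<in> E" "\<And>e'. e' \<in> E \<Longrightarrow> e' \<le> e"
      using compact_attains_sup[of E] assms(3) by (auto simp: KR_def)
    obtain f where f: "f \<in> E" "\<And>e'. e' \<in> E \<Longrightarrow> f \<le> e'"
      using compact_attains_inf[of E] assms(3) by (auto simp: KR_def)
    obtain u where u: "u \<in> D + E" "dist (x + e) u \<le> r"
      unfolding r_def using hausdorff_dist_attained[OF K(3,4)] x e(1) by blast
    obtain v where v: "v \<in> D + E" "dist (x + f) v \<le> r"
      unfolding r_def using hausdorff_dist_attained[OF K(3,4)] x f(1) by blast
    have "u \<le> q + e"
      using u(1) e(2) pq(1) by (fastforce simp: set_plus_def intro: add_mono)
    with u(2) have q: "x \<le> q + r" by (simp add: dist_real_def)
    have "p + f \<le> v"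
      using v(1) f(2) pq(1) by (fastforce simp: set_plus_def intro: add_mono)
    with v(2) have p: "p \<le> x + r" by (simp add: dist_real_def)
    have "0 \<le> r" by (simp add: r_def hausdorff_dist_nonneg)
    \<comment> \<open>The witness is the point of \<open>{p..q}\<close> nearest to
      \<open>x\<close>.\<close>
    with p q pq(2) have "\<exists>y\<in>D. dist x y \<le> r"
      unfolding pq(1) dist_real_def
      by (intro bexI[of _ "max p (min x q)"]) auto
    then show ?thesis
      unfolding r_def using infdist_le order_trans by metis
  qed
  show ?thesis
    using *[OF assms(1,2)] *[OF assms(2,1)] assms
    by (intro hausdorff_dist_leI) (auto simp: KcR_iff hausdorff_dist_commute[of "D + E"])
qed

section \<open>Continuity into spaces of compact sets, expressed by sequences\<close>

lemma continuous_into_in: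
  assumes "continuous_into I M f" "M \<subseteq> KR" "x \<in> I"
  shows "f x \<in> M"
proof -
  interpret M: Metric_space M hausdorff_dist
    using Metric_space.subspace[OF Metric_space_hausdorff_dist assms(2)] .
  show ?thesis
    using assms(1,3) unfolding continuous_into_def continuous_map_def by auto
qed

lemma continuous_into_tendsto:
  assumes "continuous_into I M f" "M \<subseteq> KR" "x \<in> I" "\<And>n. X n \<in> I" "X \<longlonglongrightarrow> x"
  shows "(\<lambda>n. hausdorff_dist (f (X n)) (f x)) \<longlonglongrightarrow> 0"
proof -
  interpret M: Metric_space M hausdorff_dist
    using Metric_space.subspace[OF Metric_space_hausdorff_dist assms(2)] .
  have "limitin (top_of_set I) X x sequentially"
    using assms(3-5) by (simp add: limitin_subtopology)
  then have "limitin M.mtopology (f \<circ> X) (f x) sequentially"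
    using assms(1) unfolding continuous_into_def by (rule continuous_map_limit[rotated])
  then show ?thesis
    by (simp add: M.limitin_metric_dist_null)
qed

text \<open>Convex hulls commute with Minkowski sums and scalings, and \<open>P\<close> is its own
  hull. So a hull point of \<open>F x\<close> has the same defect as a hull point of
  \<open>F y\<close>, multiplied by \<bar>r\<bar>. Iterating \<open>k\<close> times from the uniform
  bound \<open>M\<close> shows that hull points lie at distance 0 from the closed set
  \<open>F x\<close>.\<close>

lemma convex_of_self_affine:
  fixes F :: "real \<Rightarrow> real set"
  assumes KR: "\<And>x. x \<in> I \<Longrightarrow> F x \<in> KR"
    and self: "\<And>x. x \<in> I \<Longrightarrow> \<exists>y\<in>I. \<exists>P. convex P \<and> F x = P + r *o F y"
    and bound: "\<And>x u v. x \<in> I \<Longrightarrow> u \<in> F x \<Longrightarrow> v \<in> F x \<Longrightarrow> dist u v \<le> M"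
    and r: "\<bar>r\<bar> < 1" and x: "x \<in> I"
  shows "convex (F x)"
proof -
  have hull: "\<exists>u\<in>F x. dist z u \<le> \<bar>r\<bar> ^ k * M" if "x \<in> I" "z \<in> convex hull F x" for x z k
    using that
  proof (induction k arbitrary: x z)
    case 0
    obtain u where u: "u \<in> F x"
      using KR[OF 0(1)] by (auto simp: KR_def)
    have "convex hull F x \<subseteq> cball u M"
      using bound[OF 0(1) u] by (intro hull_minimal) auto
    with 0(2) have "dist z u \<le> M" by (auto simp: dist_commute)
    with u show ?case by auto
  next
    case (Suc k)
    obtain y P where y: "y \<in> I" "convex P" "F x = P + r *o F y"
      using self[OF Suc.prems(1)] by blast
    have "convex hull F x = P + r *o (convex hull F y)"
      unfolding y(3) convex_hull_set_plus elt_set_times_eq_image convex_hull_scaling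
      by (simp add: hull_same[of convex, OF y(2)])
    then obtain p w where w: "p \<in> P" "w \<in> convex hull F y" "z = p + r * w"
      using Suc.prems(2) by (auto simp: set_plus_def elt_set_times_def)
    obtain u where u: "u \<in> F y" "dist w u \<le> \<bar>r\<bar> ^ k * M"
      using Suc.IH[OF y(1) w(2)] by blast
    have "dist z (p + r * u) = \<bar>r\<bar> * dist w u"
      unfolding w(3) dist_real_def abs_mult[symmetric] by (simp add: right_diff_distrib)
    also have "\<dots> \<le> \<bar>r\<bar> * (\<bar>r\<bar> ^ k * M)"
      using u(2) by (intro mult_left_mono) auto
    finally have "dist z (p + r * u) \<le> \<bar>r\<bar> ^ Suc k * M"
      by (simp add: mult.assoc)
    moreover have "p + r * u \<in> F x"
      using w(1) u(1) y(3) by auto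
    ultimately show ?case by blast
  qed
  have "convex hull F x \<subseteq> F x"
  proof
    fix z assume z: "z \<in> convex hull F x"
    have "infdist z (F x) \<le> \<bar>r\<bar> ^ k * M" for k
      using hull[OF x z, of k] infdist_le order_trans by metis
    moreover have "(\<lambda>k. \<bar>r\<bar> ^ k * M) \<longlonglongrightarrow> 0"
      using r by (auto intro!: tendsto_mult_left_zero LIMSEQ_power_zero)
    ultimately have "infdist z (F x) \<le> 0"
      by (intro LIMSEQ_le_const) auto
    then have "infdist z (F x) = 0"
      using infdist_nonneg[of z "F x"] by linarith
    then show "z \<in> F x"
      using KR[OF x] in_closed_iff_infdist_zero[of "F x" z] by (auto simp: KR_def compact_imp_closed)
  qed
  then show ?thesis
    by (metis convex_convex_hull hull_subset subset_antisym)
qed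

section \<open>Bi-Lipschitz images of an interval\<close>

lemma diam_le_iff: "diam d U \<le> ennreal r \<longleftrightarrow> (\<forall>x\<in>U. \<forall>y\<in>U. ennreal (d x y) \<le> ennreal r)"
  by (simp add: diam_def SUP_le_iff)

lemma diam_empty [simp]: "diam d {} = 0"
  by (simp add: diam_def bot_ennreal)

text \<open>The bound by \<open>r\<close> makes the diameter finite; \<open>enn2real\<close> would
  send an infinite diameter to 0.\<close>

lemma le_enn2real_diam:
  assumes "diam d U \<le> ennreal r" "x \<in> U" "y \<in> U" "0 \<le> d x y"
  shows "d x y \<le> enn2real (diam d U)"
proof -
  have "ennreal (d x y) \<le> diam d U"
    unfolding diam_def using assms(2,3) by (intro SUP_upper2[of x] SUP_upper2[of y]) auto
  moreover have "diam d U < top"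
    using assms(1) by (simp add: le_less_trans)
  ultimately show ?thesis
    using assms(4) by (metis enn2real_ennreal enn2real_mono)
qed

text \<open>The lower constant is normalised to 1, which is what projecting a graph to its first
  coordinate gives.\<close>

locale bilipschitz_arc =
  fixes d :: "'a \<Rightarrow> 'a \<Rightarrow> real" and g :: "real \<Rightarrow> 'a" and p q K :: real
  assumes less: "p < q"
    and lower: "\<And>x y. x \<in> {p..q} \<Longrightarrow> y \<in> {p..q} \<Longrightarrow> \<bar>x - y\<bar> \<le> d (g x) (g y)"
    and upper: "\<And>x y. x \<in> {p..q} \<Longrightarrow> y \<in> {p..q} \<Longrightarrow> d (g x) (g y) \<le> K * \<bar>x - y\<bar>"
begin

abbreviation arc :: "'a set" where "arc \<equiv> g ` {p..q}"

lemma K_ge_1: "1 \<le> K"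
proof -
  have "1 * (q - p) \<le> K * (q - p)"
    using less order_trans[OF lower[of p q] upper[of p q]] by (simp add: abs_minus_commute[of p] del: mult_le_cancel_right1)
  then show ?thesis
    using less by (simp only: mult_le_cancel_right_pos diff_gt_0_iff_gt)
qed

text \<open>Since \<open>g\<close> does not shrink distances, the preimage of \<open>U\<close> is no
  wider than \<open>U\<close>; the interval starts at the infimum of that preimage.\<close>

lemma preimage_in_interval:
  assumes "diam d U \<le> ennreal r"
  obtains l where "{x \<in> {p..q}. g x \<in> U} \<subseteq> {l..l + enn2real (diam d U)}"
proof (cases "{x \<in> {p..q}. g x \<in> U} = {}")
  case False
  define V where "V = {x \<in> {p..q}. g x \<in> U}"
  have bdd: "bdd_below V"
    by (auto simp: V_def intro!: bdd_belowI[of _ p])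
  have "V \<subseteq> {Inf V..Inf V + enn2real (diam d U)}"
  proof
    fix x assume x: "x \<in> V"
    have "x - enn2real (diam d U) \<le> Inf V"
    proof (rule cInf_greatest)
      show "V \<noteq> {}" using x by blast
      fix y assume y: "y \<in> V"
      have xy: "x \<in> {p..q}" "y \<in> {p..q}" "g x \<in> U" "g y \<in> U"
        using x y by (auto simp: V_def)
      have "d (g x) (g y) \<le> enn2real (diam d U)"
        using lower[OF xy(1,2)] by (intro le_enn2real_diam[OF assms xy(3,4)]) linarith
      with lower[OF xy(1,2)] show "x - enn2real (diam d U) \<le> y"
        by linarith
    qed
    with cInf_lower[OF x bdd] show "x \<in> {Inf V..Inf V + enn2real (diam d U)}"
      by simp
  qed
  then show thesis
    using that V_def by blast
qed (use that in blast)

text \<open>The preimages of the covering sets lie in intervals that cover \<open>{p..q}\<close>,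
  and Lebesgue measure is countably subadditive.\<close>

lemma length_le_suminf_diam:
  assumes "arc = (\<Union>n. U n)" "\<And>n. diam d (U n) \<le> ennreal r"
  shows "ennreal (q - p) \<le> (\<Sum>n. ennreal (enn2real (diam d (U n))))"
proof -
  have "\<exists>l. {x \<in> {p..q}. g x \<in> U n} \<subseteq> {l..l + enn2real (diam d (U n))}" for n
    by (rule preimage_in_interval[OF assms(2)[of n]]) (rule exI)
  then obtain l where l: "\<And>n. {x \<in> {p..q}. g x \<in> U n} \<subseteq> {l n..l n + enn2real (diam d (U n))}"
    by metis
  have "{p..q} \<subseteq> (\<Union>n. {l n..l n + enn2real (diam d (U n))})"
  proof
    fix x assume x: "x \<in> {p..q}"
    then obtain n where "g x \<in> U n"
      using assms(1) by blast
    with x l show "x \<in> (\<Union>n. {l n..l n + enn2real (diam d (U n))})"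
      by blast
  qed
  then have "emeasure lborel {p..q} \<le> emeasure lborel (\<Union>n. {l n..l n + enn2real (diam d (U n))})"
    by (intro emeasure_mono) auto
  also have "\<dots> \<le> (\<Sum>n. emeasure lborel {l n..l n + enn2real (diam d (U n))})"
    by (intro emeasure_subadditive_countably) auto
  finally show ?thesis
    using less by simp
qed

lemma length_le_card_mult:
  assumes "finite_cover d r arc \<U>" "0 < r"
  shows "q - p \<le> real (card \<U>) * r"
proof -
  have fin: "finite \<U>" and arc: "arc = \<Union>\<U>" and diam: "\<And>U. U \<in> \<U> \<Longrightarrow> diam d U \<le> ennreal r"
    using assms(1) by (auto simp: finite_cover_def)
  have "\<exists>l. {x \<in> {p..q}. g x \<in> U} \<subseteq> {l..l + r}" if U: "U \<in> \<U>" for U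
  proof -
    obtain l where l: "{x \<in> {p..q}. g x \<in> U} \<subseteq> {l..l + enn2real (diam d U)}"
      using preimage_in_interval[OF diam[OF U]] .
    have "enn2real (diam d U) \<le> r"
      using diam[OF U] assms(2) by (intro enn2real_leI) auto
    then have "{l..l + enn2real (diam d U)} \<subseteq> {l..l + r}"
      by auto
    with l show ?thesis
      by (intro exI[of _ l]) (rule order_trans)
  qed
  then obtain l where l: "\<And>U. U \<in> \<U> \<Longrightarrow> {x \<in> {p..q}. g x \<in> U} \<subseteq> {l U..l U + r}"
    by metis
  have "{p..q} \<subseteq> (\<Union>U\<in>\<U>. {l U..l U + r})"
  proof
    fix x assume x: "x \<in> {p..q}"
    then obtain U where "U \<in> \<U>" "g x \<in> U"
      using arc by blast
    with x l[of U] show "x \<in> (\<Union>U\<in>\<U>. {l U..l U + r})"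
      by blast
  qed
  then have "emeasure lborel {p..q} \<le> emeasure lborel (\<Union>U\<in>\<U>. {l U..l U + r})"
    using fin by (intro emeasure_mono) auto
  also have "\<dots> \<le> (\<Sum>U\<in>\<U>. emeasure lborel {l U..l U + r})"
    using fin by (intro emeasure_subadditive_finite) auto
  also have "\<dots> = ennreal (real (card \<U>) * r)"
    using assms(2) by (simp add: ennreal_mult flip: ennreal_of_nat_eq_real_of_nat)
  finally show ?thesis
    using less assms(2) by simp
qed

section \<open>Covers of the arc by images of equal subintervals\<close>

definition piece :: "nat \<Rightarrow> nat \<Rightarrow> 'a set" where
  "piece m i = g ` {p + real i * (q - p) / real m..p + real (Suc i) * (q - p) / real m}"

lemma Union_piece:
  assumes "0 < m"
  shows "(\<Union>i<m. piece m i) = arc"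
proof
  show "(\<Union>i<m. piece m i) \<subseteq> arc"
  proof -
    have "p \<le> p + real i * (q - p) / real m" "p + real (Suc i) * (q - p) / real m \<le> q"
      if "i < m" for i
    proof -
      have "real (Suc i) * (q - p) \<le> real m * (q - p)"
        using that less by (intro mult_right_mono) auto
      then show "p + real (Suc i) * (q - p) / real m \<le> q"
        using assms by (simp add: field_simps)
    qed (use less in auto)
    then show ?thesis
      unfolding piece_def by (intro UN_least image_mono) auto
  qed
  show "arc \<subseteq> (\<Union>i<m. piece m i)"
  proof
    fix e assume "e \<in> arc"
    then obtain x where x: "p \<le> x" "x \<le> q" "e = g x" by auto
    \<comment> \<open>The floor of the rescaled position gives the index, except at
      \<open>q\<close>, where it would give \<open>m\<close> instead of the last index
      \<open>m - 1\<close>.\<close>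
    show "e \<in> (\<Union>i<m. piece m i)"
    proof (cases "x = q")
      case True
      have "e \<in> piece m (m - 1)"
        using assms less True x unfolding piece_def by (intro image_eqI[of _ _ q]) (auto simp: field_simps)
      with assms show ?thesis by (intro UN_I[of "m - 1"]) auto
    next
      case False
      define y where "y = (x - p) * real m / (q - p)"
      define i where "i = nat \<lfloor>y\<rfloor>"
      have y: "0 \<le> y" "y < real m"
        using x False less assms by (auto simp: y_def field_simps)
      have i: "real i \<le> y" "y \<le> real (Suc i)"
        using y(1) unfolding i_def by linarith+
      have "i < m" using i(1) y(2) by linarith
      moreover have "x = p + y * (q - p) / real m"
        using assms less by (simp add: y_def)
      then have "e \<in> piece m i"
        using i less x(3) assms unfolding piece_def
        by (intro image_eqI[of _ _ x]) (auto intro!: divide_right_mono mult_right_mono)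
      ultimately show ?thesis by blast
    qed
  qed
qed

lemma diam_piece_le:
  assumes "i < m"
  shows "diam d (piece m i) \<le> ennreal (K * (q - p) / real m)"
  unfolding diam_le_iff
proof (intro ballI ennreal_leI)
  fix e e' assume e: "e \<in> piece m i" "e' \<in> piece m i"
  obtain x y where xy: "e = g x" "e' = g y"
    "x \<in> {p + real i * (q - p) / real m..p + real (Suc i) * (q - p) / real m}"
    "y \<in> {p + real i * (q - p) / real m..p + real (Suc i) * (q - p) / real m}"
    using e by (auto simp: piece_def)
  have "0 \<le> real i * (q - p) / real m"
    using less by simp
  moreover have "real (Suc i) * (q - p) / real m \<le> real m * (q - p) / real m"
    using assms less by (intro divide_right_mono mult_right_mono) auto
  then have "real (Suc i) * (q - p) / real m \<le> q - p"
    using assms by simp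
  ultimately have I: "x \<in> {p..q}" "y \<in> {p..q}"
    using xy(3,4) by auto
  have "\<bar>x - y\<bar> \<le> (q - p) / real m"
    using xy(3,4) by (auto simp: add_divide_distrib distrib_right)
  then have "K * \<bar>x - y\<bar> \<le> K * ((q - p) / real m)"
    using K_ge_1 by (intro mult_left_mono) auto
  with upper[OF I] xy(1,2) show "d e e' \<le> K * (q - p) / real m"
    by simp
qed

lemma finite_cover_pieces:
  assumes "0 < m" "K * (q - p) / real m \<le> r"
  shows "finite_cover d r arc (piece m ` {..<m})"
  unfolding finite_cover_def
  using Union_piece[OF assms(1)] by (auto intro: order_trans[OF diam_piece_le ennreal_leI[OF assms(2)]])

lemma ex_finite_cover:
  assumes "0 < r"
  shows "\<exists>\<U>. finite_cover d r arc \<U> \<and> real (card \<U>) \<le> K * (q - p) / r + 1"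
proof -
  \<comment> \<open>This is the least number of pieces whose diameter bound is at most
    \<open>r\<close>; rounding up costs the summand 1.\<close>
  define m where "m = nat \<lceil>K * (q - p) / r\<rceil>"
  have pos: "0 < K * (q - p) / r"
    using assms less K_ge_1 by auto
  then have m: "K * (q - p) / r \<le> real m" "real m \<le> K * (q - p) / r + 1" "0 < m"
    unfolding m_def by linarith+
  have "K * (q - p) / real m \<le> r"
    using m(1,3) assms by (simp add: field_simps)
  then have "finite_cover d r arc (piece m ` {..<m})"
    using m(3) by (rule finite_cover_pieces[rotated])
  moreover have "card (piece m ` {..<m}) \<le> m"
    using card_image_le[of "{..<m}" "piece m"] by simp
  ultimately show ?thesis
    using m(2) by (meson of_nat_le_iff order_trans)
qed

lemma covering_number_bounds:
  assumes "0 < r"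
  shows "(q - p) / r \<le> real (covering_number d r arc)"
    and "real (covering_number d r arc) \<le> K * (q - p) / r + 1"
proof -
  obtain \<U> where \<U>: "finite_cover d r arc \<U>" "real (card \<U>) \<le> K * (q - p) / r + 1"
    using ex_finite_cover[OF assms] by blast
  have "\<exists>\<V>. finite_cover d r arc \<V> \<and> card \<V> = covering_number d r arc"
    unfolding covering_number_def by (rule LeastI[of _ "card \<U>"]) (use \<U> in blast)
  then show "(q - p) / r \<le> real (covering_number d r arc)"
    using length_le_card_mult[OF _ assms] assms by (metis divide_le_eq)
  have "covering_number d r arc \<le> card \<U>"
    unfolding covering_number_def by (rule Least_le) (use \<U> in blast)
  with \<U>(2) show "real (covering_number d r arc) \<le> K * (q - p) / r + 1"
    by linarith
qed

text \<open>For \<open>r < 1\<close> the covering number lies between \<open>(q - p) / r\<close> and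
  \<open>L / r\<close>. After taking logarithms and dividing by \<open>- ln r\<close>, both bounds
  are 1 plus a constant over \<open>- ln r\<close>.\<close>

lemma has_box_dim_arc: "has_box_dim d arc 1"
proof -
  define L where "L = K * (q - p) + 1"
  have L: "0 < L"
    using K_ge_1 less by (simp add: L_def add_pos_pos)
  have bounds: "eventually (\<lambda>r. 1 + ln (q - p) / - ln r \<le> ln (real (covering_number d r arc)) / - ln r
      \<and> ln (real (covering_number d r arc)) / - ln r \<le> 1 + ln L / - ln r) (at_right 0)"
  proof (rule eventually_at_rightI[of 0 1])
    fix r :: real assume "r \<in> {0<..<1}"
    then have r: "0 < r" "r < 1" and neg: "0 < - ln r" by auto
    let ?N = "real (covering_number d r arc)"
    have N: "(q - p) / r \<le> ?N" "?N \<le> K * (q - p) / r + 1"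
      using covering_number_bounds[OF r(1)] by auto
    have pos: "0 < (q - p) / r" using less r by simp
    have "1 \<le> 1 / r"
      using r by simp
    \<comment> \<open>The extra 1 in the covering bound is absorbed into \<open>L\<close>, as 1
      \<le> \<open>1 / r\<close>.\<close>
    then have "?N \<le> L / r"
      unfolding L_def add_divide_distrib using N(2) by linarith
    then have "ln ?N \<le> ln (L / r)"
      using pos N(1) by simp
    moreover have "ln ((q - p) / r) \<le> ln ?N"
      using pos N(1) by simp
    ultimately have "ln (q - p) - ln r \<le> ln ?N" "ln ?N \<le> ln L - ln r"
      using L less r by (simp_all add: ln_div)
    then have "(ln (q - p) - ln r) / - ln r \<le> ln ?N / - ln r" "ln ?N / - ln r \<le> (ln L - ln r) / - ln r"
      using neg by (intro divide_right_mono; simp)+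
    then show "1 + ln (q - p) / - ln r \<le> ln ?N / - ln r \<and> ln ?N / - ln r \<le> 1 + ln L / - ln r"
      using neg by (simp add: diff_divide_distrib)
  qed simp
  have lim: "((\<lambda>r. 1 + k / - ln r) \<longlongrightarrow> 1) (at_right 0)" for k :: real
  proof -
    have "filterlim (\<lambda>r. - ln r :: real) at_top (at_right 0)"
      using ln_at_0 by (simp add: filterlim_uminus_at_bot)
    then have "((\<lambda>r. k / - ln r) \<longlongrightarrow> 0) (at_right 0)"
      by (intro tendsto_divide_0[OF tendsto_const] filterlim_at_top_imp_at_infinity)
    then show ?thesis
      using tendsto_add[OF tendsto_const[of 1], of "\<lambda>r. k / - ln r" 0] by simp
  qed
  have "((\<lambda>r. ln (real (covering_number d r arc)) / - ln r) \<longlongrightarrow> 1) (at_right 0)"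
    using bounds by (intro tendsto_sandwich[OF _ _ lim[of "ln (q - p)"] lim[of "ln L"]])
      (auto elim: eventually_mono)
  then have "((\<lambda>r. ereal (ln (real (covering_number d r arc)) / - ln r)) \<longlongrightarrow> 1) (at_right 0)"
    by (simp add: one_ereal_def)
  then show ?thesis
    unfolding has_box_dim_def using ex_finite_cover by blast
qed

text \<open>At scale 1 all diameters are at most 1, so raising them to a power \<open>s\<close>
  \<le> 1 does not decrease them, and the sum still dominates the length of the interval.\<close>

lemma hausdorff_premeasure_ge_length:
  assumes "s \<le> 1"
  shows "ennreal (q - p) \<le> hausdorff_premeasure d s 1 arc"
  unfolding hausdorff_premeasure_def
proof (rule INF_greatest, clarify)
  fix U :: "nat \<Rightarrow> 'a set"
  assume U: "arc = (\<Union>n. U n)" "\<forall>n. diam d (U n) \<le> ennreal 1"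
  have "x \<le> x powr s" if "0 \<le> x" "x \<le> 1" for x :: real
  proof (cases "x = 0")
    case False
    then show ?thesis
      using that assms powr_mono'[of s 1 x] by simp
  qed simp
  moreover have "enn2real (diam d (U n)) \<le> 1" for n
    using U(2) by (intro enn2real_leI) auto
  ultimately have "ennreal (enn2real (diam d (U n))) \<le> ennreal (enn2real (diam d (U n)) powr s)" for n
    by (intro ennreal_leI) auto
  then have "(\<Sum>n. ennreal (enn2real (diam d (U n)))) \<le> (\<Sum>n. ennreal (enn2real (diam d (U n)) powr s))"
    by (intro suminf_le) auto
  then show "ennreal (q - p) \<le> (\<Sum>n. ennreal (enn2real (diam d (U n)) powr s))"
    by (rule order_trans[OF length_le_suminf_diam[OF U(1) spec[OF U(2)]]])
qed

text \<open>A cover by \<open>m\<close> pieces costs at most \<open>m\<close> times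
  \<open>(L / m) powr s\<close>, that is \<open>L powr s\<close> times
  \<open>m powr (1 - s)\<close>, which tends to 0.\<close>

lemma hausdorff_premeasure_eq_0:
  assumes "1 < s" "0 < r"
  shows "hausdorff_premeasure d s r arc = 0"
proof -
  define L where "L = K * (q - p)"
  have L: "0 < L" using K_ge_1 less by (simp add: L_def)
  have le: "hausdorff_premeasure d s r arc \<le> ennreal (real m * (L / real m) powr s)"
    if m: "L / r \<le> real m" "0 < m" for m
  proof -
    \<comment> \<open>The premeasure asks for a sequence, so the finite cover is padded with empty
      sets, which add 0 to the sum.\<close>
    define U where "U i = (if i < m then piece m i else {})" for i
    have diam: "diam d (U i) \<le> ennreal (if i < m then L / real m else 0)" for i
      using diam_piece_le[of i m] by (simp add: U_def L_def)
    have "(\<Union>i. U i) = (\<Union>i<m. piece m i)"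
      by (auto simp: U_def split: if_splits)
    then have "arc = (\<Union>i. U i)"
      using Union_piece[OF m(2)] by simp
    moreover have "(if i < m then L / real m else 0) \<le> r" for i
      using m assms(2) by (simp add: field_simps)
    then have "\<forall>i. diam d (U i) \<le> ennreal r"
      using diam by (meson ennreal_leI order_trans)
    ultimately have "hausdorff_premeasure d s r arc \<le> (\<Sum>i. ennreal (enn2real (diam d (U i)) powr s))"
      unfolding hausdorff_premeasure_def by (intro INF_lower) auto
    also have "\<dots> = (\<Sum>i<m. ennreal (enn2real (diam d (U i)) powr s))"
      by (rule suminf_finite) (auto simp: U_def)
    also have "\<dots> \<le> (\<Sum>i<m. ennreal ((L / real m) powr s))"
    proof (intro sum_mono ennreal_leI powr_mono2)
      fix i assume "i \<in> {..<m}"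
      then show "enn2real (diam d (U i)) \<le> L / real m"
        using diam[of i] L by (intro enn2real_leI) auto
    qed (use assms in auto)
    also have "\<dots> = ennreal (real m * (L / real m) powr s)"
      by (simp add: ennreal_mult flip: ennreal_of_nat_eq_real_of_nat)
    finally show ?thesis .
  qed
  have "(\<lambda>m. real m powr (1 - s)) \<longlonglongrightarrow> 0"
    using assms(1) by (intro tendsto_neg_powr filterlim_real_sequentially) auto
  then have "(\<lambda>m. ennreal (L powr s * real m powr (1 - s))) \<longlonglongrightarrow> ennreal (L powr s * 0)"
    by (intro tendsto_ennrealI tendsto_mult_left)
  moreover have "eventually (\<lambda>m. hausdorff_premeasure d s r arc
      \<le> ennreal (L powr s * real m powr (1 - s))) sequentially"
    using eventually_gt_at_top[of 0] eventually_ge_at_top[of "nat \<lceil>L / r\<rceil>"]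
  proof eventually_elim
    case (elim m)
    have "real m * (L / real m) powr s = L powr s * real m powr (1 - s)"
      using L elim by (simp add: powr_divide powr_diff)
    moreover have "L / r \<le> real m"
      using elim by linarith
    ultimately show ?case
      using le[of m] elim by simp
  qed
  ultimately have "hausdorff_premeasure d s r arc \<le> ennreal (L powr s * 0)"
    by (intro tendsto_lowerbound) auto
  then show ?thesis by simp
qed

lemma hausdorff_dim_arc: "hausdorff_dim d arc = 1"
proof (rule antisym)
  show "1 \<le> hausdorff_dim d arc"
    unfolding hausdorff_dim_def
  proof (rule Inf_greatest, clarify)
    fix s assume s: "0 < s" "hausdorff_measure d s arc = 0"
    have "hausdorff_premeasure d s 1 arc \<le> hausdorff_measure d s arc"
      unfolding hausdorff_measure_def by (intro SUP_upper) auto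
    then have "\<not> ennreal (q - p) \<le> hausdorff_premeasure d s 1 arc"
      using s(2) less by simp
    then show "1 \<le> ereal s"
      using hausdorff_premeasure_ge_length[of s] by (cases "s \<le> 1") (auto simp: one_ereal_def)
  qed
  show "hausdorff_dim d arc \<le> 1"
  proof (rule ereal_le_epsilon2)
    fix e :: real assume "0 < e"
    then have "hausdorff_measure d (1 + e) arc = 0"
      unfolding hausdorff_measure_def
      by (simp add: hausdorff_premeasure_eq_0 SUP_eq_const)
    then have "hausdorff_dim d arc \<le> ereal (1 + e)"
      unfolding hausdorff_dim_def using \<open>0 < e\<close> by (intro Inf_lower) auto
    then show "hausdorff_dim d arc \<le> 1 + ereal e"
      by (simp add: one_ereal_def)
  qed
qed

end

section \<open>The similarity dimension equation\<close>

lemma sum_powr_strict_antimono: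
  fixes b :: "'i \<Rightarrow> real"
  assumes "finite A" "A \<noteq> {}" "\<And>i. i \<in> A \<Longrightarrow> 0 < b i \<and> b i < 1" "s < s'"
  shows "(\<Sum>i\<in>A. b i powr s') < (\<Sum>i\<in>A. b i powr s)"
  using assms by (intro sum_strict_mono) (auto simp: powr_less_mono')

text \<open>At exponent 0 the sum is the cardinality of \<open>A\<close>, hence at least 1, and at
  large integer exponents it is below 1. The intermediate value theorem gives a solution, strict
  monotonicity its uniqueness.\<close>

lemma ex1_sum_powr_eq_1:
  fixes b :: "'i \<Rightarrow> real"
  assumes A: "finite A" "A \<noteq> {}" and b: "\<And>i. i \<in> A \<Longrightarrow> 0 < b i \<and> b i < 1"
  shows "\<exists>!s. (\<Sum>i\<in>A. b i powr s) = 1"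
proof -
  let ?f = "\<lambda>s. \<Sum>i\<in>A. b i powr s"
  have "(\<lambda>n. \<Sum>i\<in>A. b i ^ n) \<longlonglongrightarrow> (\<Sum>i\<in>A. 0)"
    using b by (intro tendsto_sum LIMSEQ_power_zero) (simp add: abs_of_pos)
  then have "eventually (\<lambda>n. (\<Sum>i\<in>A. b i ^ n) < 1) sequentially"
    by (intro order_tendstoD(2)[of _ "\<Sum>i\<in>A. 0"]) auto
  then obtain n where "(\<Sum>i\<in>A. b i ^ n) < 1"
    using eventually_happens'[OF sequentially_bot] by blast
  moreover have "(\<Sum>i\<in>A. b i ^ n) = ?f (real n)"
    using b by (intro sum.cong) (auto simp: powr_realpow)
  moreover have "?f 0 = (\<Sum>i\<in>A. 1)"
    using b by (intro sum.cong) force+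
  then have "1 \<le> ?f 0"
    using A by (simp add: Suc_le_eq card_gt_0_iff)
  moreover have "continuous_on {0..real n} ?f"
    using b by (intro continuous_intros) force
  ultimately obtain s where "?f s = 1"
    using IVT2'[of ?f "real n" 1 0] by auto
  moreover have "s = s'" if "?f s = 1" "?f s' = 1" for s s'
    using that sum_powr_strict_antimono[of A b s s'] sum_powr_strict_antimono[of A b s' s] A b
    by (cases s s' rule: linorder_cases) auto
  ultimately show ?thesis by blast
qed

text \<open>The sum strictly decreases in the exponent and is already at most 1 at exponent 1, so it
  cannot equal 1 at a larger one.\<close>

lemma s_fin_le_1:
  assumes "1 \<le> k" "\<And>i. 1 \<le> i \<Longrightarrow> 0 < b i \<and> b i < 1" "(\<Sum>i=1..k. b i) \<le> 1"
  shows "s_fin b k \<le> 1"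
proof (rule ccontr)
  assume "\<not> s_fin b k \<le> 1"
  then have "(\<Sum>i=1..k. b i powr s_fin b k) < (\<Sum>i=1..k. b i powr 1)"
    using assms(1,2) by (intro sum_powr_strict_antimono) auto
  also have "\<dots> = (\<Sum>i=1..k. b i)"
    using assms(2) by (intro sum.cong) (auto simp: less_imp_le)
  finally have "(\<Sum>i=1..k. b i powr s_fin b k) < 1"
    using assms(3) by linarith
  moreover have "(\<Sum>i=1..k. b i powr s_fin b k) = 1"
    unfolding s_fin_def
    by (rule theI'[OF ex1_sum_powr_eq_1]) (use assms(1,2) in auto)
  ultimately show False by simp
qed

section \<open>The fractal function\<close>

text \<open>The summand \<open>C\<close> is the same for all \<open>n\<close>, so only
  \<open>F\<close> and \<Phi> vary along the sequence, and adding \<open>C\<close> does not increase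
  distances. It will be applied along \<open>\<zeta> (Suc n) x\<close> for a fixed
  \<open>x\<close>.\<close>

lemma fractal_equation_at_limit:
  assumes "continuous_into I M F" "M \<subseteq> KR" "continuous_into I N \<Phi>" "N \<subseteq> KR"
    and X: "\<And>n. X n \<in> I" "X \<longlonglongrightarrow> z" "z \<in> I"
    and C: "C \<in> KR" and eq: "\<And>n. F (X n) = \<Phi> (X n) + C"
  shows "F z = \<Phi> z + C"
proof -
  have KR: "F x \<in> KR" "\<Phi> x \<in> KR" if "x \<in> I" for x
    using continuous_into_in[OF assms(1,2) that] continuous_into_in[OF assms(3,4) that] assms(2,4)
    by auto
  have "hausdorff_dist (F z) (\<Phi> z + C)
      \<le> hausdorff_dist (F (X n)) (F z) + hausdorff_dist (\<Phi> (X n)) (\<Phi> z)" for n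
  proof -
    have "hausdorff_dist (F z) (\<Phi> z + C)
        \<le> hausdorff_dist (F z) (F (X n)) + hausdorff_dist (F (X n)) (\<Phi> z + C)"
      using X KR C by (intro hausdorff_dist_triangle KR_plus) auto
    also have "hausdorff_dist (F (X n)) (\<Phi> z + C) \<le> hausdorff_dist (\<Phi> (X n)) (\<Phi> z)"
      unfolding eq using X KR C by (intro hausdorff_dist_plus_le) auto
    finally show ?thesis
      by (simp add: hausdorff_dist_commute)
  qed
  moreover have "(\<lambda>n. hausdorff_dist (F (X n)) (F z) + hausdorff_dist (\<Phi> (X n)) (\<Phi> z)) \<longlonglongrightarrow> 0 + 0"
    using assms by (intro tendsto_add continuous_into_tendsto)
  ultimately have "hausdorff_dist (F z) (\<Phi> z + C) \<le> 0 + 0"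
    by (intro LIMSEQ_le_const) auto
  then have "hausdorff_dist (F z) (\<Phi> z + C) = 0"
    using hausdorff_dist_nonneg[of "F z" "\<Phi> z + C"] by linarith
  then show ?thesis
    using hausdorff_dist_eq_0[of "F z" "\<Phi> z + C"] KR X C KR_plus by auto
qed

text \<open>Both sequences have the same limit \<open>z\<close>, so replacing \<Phi> at either by
  \<open>\<Phi> z\<close> costs errors that vanish, and the bound \<open>r\<close> survives.\<close>

lemma hausdorff_dist_bound_at_limit:
  assumes "continuous_into I N \<Phi>" "N \<subseteq> KR"
    and X: "\<And>n. X n \<in> I" "X \<longlonglongrightarrow> z" and Y: "\<And>n. Y n \<in> I" "Y \<longlonglongrightarrow> z" and z: "z \<in> I"
    and CD: "C \<in> KR" "D \<in> KR"
    and le: "\<And>n. hausdorff_dist (\<Phi> (X n) + C) (\<Phi> (Y n) + D) \<le> r"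
  shows "hausdorff_dist (\<Phi> z + C) (\<Phi> z + D) \<le> r"
proof -
  have KR: "\<Phi> x \<in> KR" if "x \<in> I" for x
    using continuous_into_in[OF assms(1,2) that] assms(2) by auto
  let ?e = "\<lambda>n. hausdorff_dist (\<Phi> (X n)) (\<Phi> z) + r + hausdorff_dist (\<Phi> (Y n)) (\<Phi> z)"
  have "hausdorff_dist (\<Phi> z + C) (\<Phi> z + D) \<le> ?e n" for n
  proof -
    have K: "\<Phi> z + C \<in> KR" "\<Phi> z + D \<in> KR" "\<Phi> (X n) + C \<in> KR" "\<Phi> (Y n) + D \<in> KR"
      using KR X Y z CD by (auto intro: KR_plus)
    have "hausdorff_dist (\<Phi> (X n) + C) (\<Phi> z + C) \<le> hausdorff_dist (\<Phi> (X n)) (\<Phi> z)"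
      "hausdorff_dist (\<Phi> (Y n) + D) (\<Phi> z + D) \<le> hausdorff_dist (\<Phi> (Y n)) (\<Phi> z)"
      using KR X Y z CD by (auto intro: hausdorff_dist_plus_le)
    moreover note hausdorff_dist_triangle[OF K(1,3,2)] hausdorff_dist_triangle[OF K(3,4,2)]
      hausdorff_dist_commute[of "\<Phi> z + C" "\<Phi> (X n) + C"] le[of n]
    ultimately show ?thesis by linarith
  qed
  moreover have "?e \<longlonglongrightarrow> 0 + r + 0"
    using assms by (intro tendsto_add tendsto_const continuous_into_tendsto)
  ultimately have "hausdorff_dist (\<Phi> z + C) (\<Phi> z + D) \<le> 0 + r + 0"
    by (intro LIMSEQ_le_const) auto
  then show ?thesis by simp
qed

text \<open>The part independent of \<open>S\<close> is grouped into one summand, so that it can be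
  isolated by \<open>S = {0}\<close> or balanced by a suitable \<open>S\<close>.\<close>

lemma ifs_map_eq: "ifs_map \<zeta> \<alpha> \<Phi> B i (x, S) = (\<zeta> i x, \<alpha> *o S + (\<Phi> (\<zeta> i x) + (- \<alpha>) *o B x))"
  by (simp add: ifs_map_def mink_diff_scale add.assoc)

theorem theorem6p2:
  fixes t :: "nat \<Rightarrow> real" and tinf :: real
    and \<zeta> :: "nat \<Rightarrow> real \<Rightarrow> real" and a b c :: "nat \<Rightarrow> real" and \<alpha> :: real
    and \<Phi> B F :: "real \<Rightarrow> real set"
  assumes "strict_mono_on {1..} t" and "t \<longlonglongrightarrow> tinf"
    and "\<And>n. n \<ge> 1 \<Longrightarrow>
           homeomorphism {t 1..tinf} {t n..t (Suc n)} (\<zeta> n) (inv_into {t 1..tinf} (\<zeta> n))"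
    and "\<And>n x y. n \<ge> 1 \<Longrightarrow> x \<in> {t 1..tinf} \<Longrightarrow> y \<in> {t 1..tinf} \<Longrightarrow>
           \<bar>\<zeta> n x - \<zeta> n y\<bar> \<le> a n * \<bar>x - y\<bar>"
    and "\<And>n. n \<ge> 1 \<Longrightarrow>
           (\<zeta> n (t 1) = t n \<and> \<zeta> n tinf = t (Suc n)) \<or> (\<zeta> n (t 1) = t (Suc n) \<and> \<zeta> n tinf = t n)"
    and "\<And>i. i \<ge> 1 \<Longrightarrow> max \<bar>\<alpha>\<bar> (a i) < 1"
    and "continuous_into {t 1..tinf} KcR B" and "continuous_into {t 1..tinf} KcR \<Phi>"
    and "B (t 1) \<ominus>\<^sub>M \<Phi> (t 1) = B tinf \<ominus>\<^sub>M \<Phi> tinf"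
    and "is_fractal_function t tinf \<zeta> \<alpha> \<Phi> B F"
    and "\<And>i. i \<ge> 1 \<Longrightarrow> 0 < b i \<and> b i \<le> c i \<and> c i < 1"
    and "\<And>i x S\<^sub>1 w S\<^sub>2. i \<ge> 1 \<Longrightarrow> (x, S\<^sub>1) \<in> {t 1..tinf} \<times> KcR \<Longrightarrow> (w, S\<^sub>2) \<in> {t 1..tinf} \<times> KcR \<Longrightarrow>
           b i * graph_metric (x, S\<^sub>1) (w, S\<^sub>2)
             \<le> graph_metric (ifs_map \<zeta> \<alpha> \<Phi> B i (x, S\<^sub>1)) (ifs_map \<zeta> \<alpha> \<Phi> B i (w, S\<^sub>2)) \<and>
           graph_metric (ifs_map \<zeta> \<alpha> \<Phi> B i (x, S\<^sub>1)) (ifs_map \<zeta> \<alpha> \<Phi> B i (w, S\<^sub>2))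
             \<le> c i * graph_metric (x, S\<^sub>1) (w, S\<^sub>2)"
  shows "(\<forall>k\<ge>2. \<exists>!s. (\<Sum>i=1..k. b i powr s) = 1) \<and>
         (\<exists>D. has_box_dim graph_metric (graph_on {t 1..tinf} F) D \<and>
              s_lower b \<le> hausdorff_dim graph_metric (graph_on {t 1..tinf} F) \<and>
              hausdorff_dim graph_metric (graph_on {t 1..tinf} F) \<le> D \<and>
              D \<le> s_upper c)"
proof -
  define I where "I = {t 1..tinf}"

  \<comment> \<open>The partition and the maps \<zeta>\<close>
  have t_less: "t m < t n" if "1 \<le> m" "m < n" for m n
    using strict_mono_onD[OF assms(1), of m n] that by simp
  have t_lt_tinf: "t n < tinf" if "1 \<le> n" for n
  proof -
    have "t (Suc n) \<le> t m" if "Suc n \<le> m" for m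
      using t_less[of "Suc n" m] that by (cases "m = Suc n") auto
    then have "t (Suc n) \<le> tinf"
      using assms(2) by (intro LIMSEQ_le_const) auto
    with t_less[of n "Suc n"] that show ?thesis by simp
  qed
  have t1_le: "t 1 \<le> t n" if "1 \<le> n" for n
    using t_less[of 1 n] that by (cases "n = 1") auto
  have sub: "{t n..t (Suc n)} \<subseteq> I" if "1 \<le> n" for n
    using t1_le[OF that] t_lt_tinf[of "Suc n"] by (auto simp: I_def)
  have ends: "t 1 \<in> I" "tinf \<in> I"
    using t_lt_tinf[of 1] by (auto simp: I_def)
  have \<zeta>_image: "\<zeta> n ` I = {t n..t (Suc n)}" and \<zeta>_inv: "x \<in> I \<Longrightarrow> inv_into I (\<zeta> n) (\<zeta> n x) = x"
    if "1 \<le> n" for n x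
    using homeomorphism_image1[OF assms(3)[OF that]] homeomorphism_apply1[OF assms(3)[OF that]]
    by (auto simp: I_def)
  have \<zeta>_in: "\<zeta> n x \<in> I" "\<zeta> n x \<in> {t n..t (Suc n)}" if "1 \<le> n" "x \<in> I" for n x
    using \<zeta>_image[OF that(1)] sub[OF that(1)] that(2) by blast+
  \<comment> \<open>The index is shifted because the assumptions on the maps start at index
    1.\<close>
  have \<zeta>_lim: "(\<lambda>n. \<zeta> (Suc n) x) \<longlonglongrightarrow> tinf" if "x \<in> I" for x
  proof (rule tendsto_sandwich)
    show "eventually (\<lambda>n. t (Suc n) \<le> \<zeta> (Suc n) x) sequentially"
      "eventually (\<lambda>n. \<zeta> (Suc n) x \<le> t (Suc (Suc n))) sequentially"
      using \<zeta>_in(2)[of "Suc _" x] that by auto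
    show "(\<lambda>n. t (Suc n)) \<longlonglongrightarrow> tinf" "(\<lambda>n. t (Suc (Suc n))) \<longlonglongrightarrow> tinf"
      using LIMSEQ_Suc[OF assms(2)] LIMSEQ_Suc[OF LIMSEQ_Suc[OF assms(2)]] by auto
  qed

  have cont: "continuous_into I KcR B" "continuous_into I KcR \<Phi>" "continuous_into I KR F"
    and F_eq': "\<And>n x. 1 \<le> n \<Longrightarrow> x \<in> {t n..t (Suc n)} \<Longrightarrow>
      F x = \<Phi> x + \<alpha> *o (F (inv_into I (\<zeta> n) x) \<ominus>\<^sub>M B (inv_into I (\<zeta> n) x))"
    using assms(7,8,10) by (auto simp: is_fractal_function_def Let_def I_def)
  have Kc: "B x \<in> KcR" "\<Phi> x \<in> KcR" and K: "F x \<in> KR" "B x \<in> KR" "\<Phi> x \<in> KR" if "x \<in> I" for x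
    using that cont KcR_subset_KR by (auto dest!: continuous_into_in)
  have F_eq: "F (\<zeta> n x) = \<Phi> (\<zeta> n x) + (\<alpha> *o F x + (- \<alpha>) *o B x)" if "1 \<le> n" "x \<in> I" for n x
    using F_eq'[OF that(1) \<zeta>_in(2)[OF that]] \<zeta>_inv[OF that] by (simp add: scale_mink_diff)
  text \<open>
    The intervals \<open>\<zeta> n ` I\<close> shrink to the point \<open>tinf\<close>, so continuity of \<open>F\<close> at \<open>tinf\<close>
    makes \<open>\<alpha> (F x - B x)\<close> essentially independent of \<open>x\<close>.
  \<close>
  have F_tinf: "F tinf = \<Phi> tinf + (\<alpha> *o F x + (- \<alpha>) *o B x)" if "x \<in> I" for x
    by (rule fractal_equation_at_limit[OF cont(3) _ cont(2) KcR_subset_KR _ \<zeta>_lim[OF that] ends(2)])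
      (use \<zeta>_in F_eq K that in \<open>auto intro!: KR_plus KR_scale\<close>)

  note ifs = assms(12)[folded I_def]
  have \<alpha>: "\<alpha> \<noteq> 0" "\<bar>\<alpha>\<bar> < 1"
  proof -
    \<comment> \<open>If these sets agreed, the first map would send two points at distance 1 to the
      same point, against \<open>0 < b 1\<close>.\<close>
    have "\<alpha> *o {0} \<noteq> \<alpha> *o {1}"
    proof
      assume "\<alpha> *o {0} = \<alpha> *o {1}"
      moreover have "hausdorff_dist C C = 0" if "C \<in> KR" for C
        using that hausdorff_dist_eq_0 by blast
      ultimately have "b 1 \<le> 0"
        using ifs[of 1 "t 1" "{0}" "t 1" "{1}"] ends(1) singleton_KcR \<zeta>_in[of 1 "t 1"] K
        by (simp add: ifs_map_eq graph_metric_def hausdorff_dist_singleton KR_plus KR_scale KcR_iff)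
      with assms(11)[of 1] show False by simp
    qed
    then show "\<alpha> \<noteq> 0"
      by (auto simp: elt_set_times_def)
    show "\<bar>\<alpha>\<bar> < 1"
      using assms(6)[of 1] by simp
  qed

  have F_convex: "convex (F x)" if "x \<in> I" for x
  proof (rule convex_of_self_affine[OF K(1) _ _ \<alpha>(2) that])
    fix x assume x: "x \<in> I"
    show "\<exists>y\<in>I. \<exists>P. convex P \<and> F x = P + \<alpha> *o F y"
    proof (cases "x = tinf")
      case True
      have "convex (\<Phi> tinf + (- \<alpha>) *o B (t 1))"
        using Kc ends KcR_plus KcR_scale KcR_iff by metis
      moreover have "F x = (\<Phi> tinf + (- \<alpha>) *o B (t 1)) + \<alpha> *o F (t 1)"
        using F_tinf[OF ends(1)] True by (simp add: ac_simps)
      ultimately show ?thesis using ends(1) by blast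
    next
      case False
      have "eventually (\<lambda>n. x < t n) sequentially"
        using assms(2) by (rule order_tendstoD) (use False x in \<open>auto simp: I_def\<close>)
      then have ex: "\<exists>n. 1 \<le> n \<and> x < t n"
        using eventually_happens'[OF sequentially_bot eventually_conj[OF eventually_ge_at_top[of 1]]]
        by blast
      \<comment> \<open>The first partition point beyond \<open>x\<close> is the right end of an
        interval containing \<open>x\<close>; its index is not 1 because \<open>x\<close> is at
        least \<open>t 1\<close>.\<close>
      define m where "m = (LEAST n. 1 \<le> n \<and> x < t n)"
      have m: "1 \<le> m" "x < t m"
        using LeastI_ex[OF ex] by (auto simp: m_def)
      have "m \<noteq> 1" using m(2) x by (auto simp: I_def)
      then obtain n where n: "m = Suc n" "1 \<le> n"
        using m(1) by (cases m) auto
      have "\<not> (1 \<le> n \<and> x < t n)"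
        using not_less_Least[of n "\<lambda>n. 1 \<le> n \<and> x < t n"] n by (simp add: m_def)
      then have "x \<in> {t n..t (Suc n)}"
        using n m(2) by auto
      then obtain y where y: "y \<in> I" "x = \<zeta> n y"
        using \<zeta>_image[OF n(2)] by blast
      have "convex (\<Phi> x + (- \<alpha>) *o B y)"
        using Kc x y(1) KcR_plus KcR_scale KcR_iff by metis
      moreover have "F x = (\<Phi> x + (- \<alpha>) *o B y) + \<alpha> *o F y"
        using F_eq[OF n(2) y(1)] y(2) by (simp add: ac_simps)
      ultimately show ?thesis using y(1) by blast
    qed
  next
    fix x u v assume x: "x \<in> I" and uv: "u \<in> F x" "v \<in> F x"
    \<comment> \<open>With one point fixed in each of \<open>\<Phi> tinf\<close> and
      \<open>B x\<close>, a translate of \<open>\<alpha> *o F x\<close> lies inside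
      \<open>F tinf\<close>. This bounds the diameters of all \<open>F x\<close> uniformly.\<close>
    obtain p c where pc: "p \<in> \<Phi> tinf" "c \<in> B x"
      using K[OF x] K[OF ends(2)] by (auto simp: KR_def)
    have "p + (\<alpha> * w + (- \<alpha>) * c) \<in> F tinf" if "w \<in> F x" for w
      unfolding F_tinf[OF x] using pc that by (intro set_plus_intro set_times_intro2)
    then have "dist (p + (\<alpha> * u + (- \<alpha>) * c)) (p + (\<alpha> * v + (- \<alpha>) * c)) \<le> diameter (F tinf)"
      using uv K(1)[OF ends(2)] by (intro diameter_bounded_bound) (auto simp: KR_def compact_imp_bounded)
    then have "\<bar>\<alpha>\<bar> * dist u v \<le> diameter (F tinf)"
      by (simp add: dist_real_def abs_mult[symmetric] right_diff_distrib)
    then show "dist u v \<le> diameter (F tinf) / \<bar>\<alpha>\<bar>"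
      using \<alpha>(1) by (simp add: field_simps)
  qed

  \<comment> \<open>With both set arguments equal to \<open>{0}\<close>, the second components of
    the images are \<open>\<Phi> (\<zeta> i x) + (- \<alpha>) *o B x\<close> and its analogue at
    \<open>w\<close>. Their distance is at most \<bar>x - w\<bar> for every \<open>i\<close>, and
    the bound passes to the limit.\<close>
  have B_lip: "hausdorff_dist (\<Phi> tinf + (- \<alpha>) *o B x) (\<Phi> tinf + (- \<alpha>) *o B w) \<le> \<bar>x - w\<bar>"
    if xw: "x \<in> I" "w \<in> I" for x w
  proof (rule hausdorff_dist_bound_at_limit[OF cont(2) KcR_subset_KR _ \<zeta>_lim[OF xw(1)] _ \<zeta>_lim[OF xw(2)] ends(2)])
    fix n
    let ?i = "Suc n"
    let ?H = "hausdorff_dist (\<Phi> (\<zeta> ?i x) + (- \<alpha>) *o B x) (\<Phi> (\<zeta> ?i w) + (- \<alpha>) *o B w)"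
    have "?H \<le> \<bar>\<zeta> ?i x - \<zeta> ?i w\<bar> + ?H"
      by simp
    also have "\<dots> \<le> c ?i * \<bar>x - w\<bar>"
    proof -
      have "\<alpha> *o {0} = (0 :: real set)"
        by (auto simp: elt_set_times_def)
      then show ?thesis
        using ifs[of ?i x "{0}" w "{0}"] xw singleton_KcR
        by (simp add: ifs_map_eq graph_metric_def hausdorff_dist_singleton)
    qed
    also have "\<dots> \<le> 1 * \<bar>x - w\<bar>"
      using assms(11)[of ?i] by (intro mult_right_mono) auto
    finally show "?H \<le> \<bar>x - w\<bar>"
      by simp
  qed (use \<zeta>_in xw K in \<open>auto intro: KR_scale\<close>)

  have F_lip: "hausdorff_dist (F x) (F w) \<le> \<bar>x - w\<bar> / \<bar>\<alpha>\<bar>" if xw: "x \<in> I" "w \<in> I" for x w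
  proof -
    let ?P = "\<lambda>z. \<Phi> tinf + (- \<alpha>) *o B z"
    have P: "?P z \<in> KR" if "z \<in> I" for z
      using that K ends by (auto intro!: KR_plus KR_scale)
    have sF: "\<alpha> *o F z \<in> KcR" if "z \<in> I" for z
      using that K F_convex by (intro KcR_scale) (simp add: KcR_iff)
    \<comment> \<open>Both sides are \<open>F tinf\<close>. Exchanging one for the other moves the
      comparison of \<open>F x\<close> with \<open>F w\<close> to \<open>?P\<close>, where
      \<open>B_lip\<close> applies; the common summand \<open>?P x\<close> is then cancelled, using
      convexity.\<close>
    have "\<alpha> *o F x + ?P x = \<alpha> *o F w + ?P w"
      using F_tinf[OF xw(1)] F_tinf[OF xw(2)] by (simp add: ac_simps)
    then have "hausdorff_dist (\<alpha> *o F x + ?P x) (\<alpha> *o F w + ?P x)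
        = hausdorff_dist (?P w + \<alpha> *o F w) (?P x + \<alpha> *o F w)"
      by (simp add: add.commute)
    also have "\<dots> \<le> hausdorff_dist (?P w) (?P x)"
      using P xw sF KcR_subset_KR by (intro hausdorff_dist_plus_le) auto
    also have "\<dots> \<le> \<bar>x - w\<bar>"
      using B_lip[OF xw(2,1)] by (simp add: abs_minus_commute)
    finally have "hausdorff_dist (\<alpha> *o F x) (\<alpha> *o F w) \<le> \<bar>x - w\<bar>"
      using hausdorff_dist_plus_cancel[OF sF[OF xw(1)] sF[OF xw(2)] P[OF xw(1)]] by linarith
    moreover have "hausdorff_dist (F x) (F w) \<le> \<bar>1 / \<alpha>\<bar> * hausdorff_dist (\<alpha> *o F x) (\<alpha> *o F w)"
      using hausdorff_dist_scale_le[of "\<alpha> *o F x" "\<alpha> *o F w" "1 / \<alpha>"] K xw \<alpha>(1)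
      by (simp add: KR_scale set_times_rearrange2)
    ultimately show ?thesis
      using \<alpha>(1) by (simp add: field_simps)
  qed

  \<comment> \<open>In the upper constant, 1 comes from the first coordinate and
    \<open>1 / \<bar>\<alpha>\<bar>\<close> from \<open>F_lip\<close>.\<close>
  interpret bilipschitz_arc graph_metric "\<lambda>x. (x, F x)" "t 1" tinf "1 + 1 / \<bar>\<alpha>\<bar>"
  proof
    fix x y assume "x \<in> {t 1..tinf}" "y \<in> {t 1..tinf}"
    then show "\<bar>x - y\<bar> \<le> graph_metric (x, F x) (y, F y)"
      "graph_metric (x, F x) (y, F y) \<le> (1 + 1 / \<bar>\<alpha>\<bar>) * \<bar>x - y\<bar>"
      using F_lip[of x y] by (auto simp: graph_metric_def hausdorff_dist_nonneg I_def distrib_right)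
  qed (use t_lt_tinf[of 1] in simp)
  have graph: "graph_on {t 1..tinf} F = arc"
    by (auto simp: graph_on_def)

  \<comment> \<open>Comparison of \<open>s_lower\<close> with 1\<close>
  have b: "0 < b i \<and> b i < 1" if "1 \<le> i" for i
    using assms(11)[OF that] by linarith
  text \<open>The two set arguments are chosen so that \<open>ifs_map\<close> sends them to the same set.\<close>
  have b_le: "b i * (tinf - t 1) \<le> t (Suc i) - t i" if i: "1 \<le> i" for i
  proof -
    let ?q = "\<lambda>x. \<Phi> (\<zeta> i x) + (- \<alpha>) *o B x"
    let ?S = "(1 / \<alpha>) *o ?q tinf" and ?T = "(1 / \<alpha>) *o ?q (t 1)"
    have q: "?q x \<in> KcR" if "x \<in> I" for x
      using that Kc \<zeta>_in[OF i that] by (intro KcR_plus KcR_scale) auto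
    have "\<alpha> *o ?S + ?q (t 1) = \<alpha> *o ?T + ?q tinf"
      using \<alpha>(1) by (simp add: set_times_rearrange2 add.commute)
    moreover have "\<alpha> *o ?T + ?q tinf \<in> KR"
      using K ends \<zeta>_in(1)[OF i] by (intro KR_plus KR_scale) auto
    ultimately have "hausdorff_dist (\<alpha> *o ?S + ?q (t 1)) (\<alpha> *o ?T + ?q tinf) = 0"
      by (metis hausdorff_dist_eq_0)
    \<comment> \<open>The image points differ only in their first coordinates, and these are the two
      ends of the \<open>i\<close>-th interval in either orientation.\<close>
    then have "b i * (\<bar>t 1 - tinf\<bar> + hausdorff_dist ?S ?T) \<le> \<bar>\<zeta> i (t 1) - \<zeta> i tinf\<bar>"
      using ifs[of i "t 1" ?S tinf ?T] i ends q
      by (simp add: ifs_map_eq graph_metric_def KcR_scale)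
    moreover have "b i * \<bar>t 1 - tinf\<bar> \<le> b i * (\<bar>t 1 - tinf\<bar> + hausdorff_dist ?S ?T)"
      using b[OF i] by (intro mult_left_mono) (auto simp: hausdorff_dist_nonneg)
    ultimately show ?thesis
      using assms(5)[OF i] t_lt_tinf[of 1] t_less[of i "Suc i"] i by auto
  qed
  have sum_b: "(\<Sum>i=1..k. b i) \<le> 1" if "1 \<le> k" for k
  proof -
    \<comment> \<open>The interval lengths telescope to at most the length of \<open>I\<close>,
      which is positive and can be divided out.\<close>
    have "(\<Sum>i=1..k. b i) * (tinf - t 1) \<le> (\<Sum>i=1..k. t (Suc i) - t i)"
      unfolding sum_distrib_right using b_le by (intro sum_mono) auto
    also have "\<dots> = t (Suc k) - t 1"
      using that by (intro sum_Suc_diff) auto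
    also have "\<dots> \<le> 1 * (tinf - t 1)"
      using t_lt_tinf[of "Suc k"] by simp
    finally show ?thesis
      using t_lt_tinf[of 1] by (simp only: mult_le_cancel_right_pos diff_gt_0_iff_gt)
  qed
  have "s_lower b \<le> 1"
    unfolding s_lower_def one_ereal_def using s_fin_le_1[of _ b] b sum_b
    by (intro SUP_least) auto
  moreover have "1 \<le> s_upper c"
    by (simp add: s_upper_def)
  moreover have "\<forall>k\<ge>2. \<exists>!s. (\<Sum>i=1..k. b i powr s) = 1"
    using b by (intro allI impI ex1_sum_powr_eq_1) auto
  ultimately show ?thesis
    unfolding graph using has_box_dim_arc hausdorff_dim_arc by auto
qed

end
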